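(* Let $q>2$ be the fixed constant used in the three-dimensional PP limiter (it can be arbitrarily specified in $(2,+\infty)$). If $\overline{\bm Q}_{ijk}^n\in\mathcal G$ for all $i,j,k$, then the updated cell averages $$\begin{aligned}\overline{\bm Q}_{ijk}^{n+1}=\overline{\bm Q}_{ijk}^{n}&-\frac{\Delta t}{\Delta x}\left(\hat{\bm G}_1\left(\widetilde{\bm Q}^{n,-}_{i+\frac12,j,k},\widetilde{\bm Q}^{n,+}_{i+\frac12,j,k}\right)-\hat{\bm G}_1\left(\widetilde{\bm Q}^{n,-}_{i-\frac12,j,k},\widetilde{\bm Q}^{n,+}_{i-\frac12,j,k}\right)\right)\\&-\frac{\Delta t}{\Delta y}\left(\hat{\bm G}_2\left(\widetilde{\bm Q}^{n,-}_{i,j+\frac12,k},\widetilde{\bm Q}^{n,+}_{i,j+\frac12,k}\right)-\hat{\bm G}_2\left(\widetilde{\bm Q}^{n,-}_{i,j-\frac12,k},\widetilde{\bm Q}^{n,+}_{i,j-\frac12,k}\right)\right)\\&-\frac{\Delta t}{\Delta z}\left(\hat{\bm G}_3\left(\widetilde{\bm Q}^{n,-}_{i,j,k+\frac12},\widetilde{\bm Q}^{n,+}_{i,j,k+\frac12}\right)-\hat{\bm G}_3\left(\widetilde{\bm Q}^{n,-}_{i,j,k-\frac12},\widetilde{\bm Q}^{n,+}_{i,j,k-\frac12}\right)\right)\end{aligned}$$ always belong to $\mathcal G$ under the CFL condition $$\Delta t\left(\frac{\alpha_1}{\Delta x}+\frac{\alpha_2}{\Delta y}+\frac{\alpha_3}{\Delta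 z}\right)\le\frac1q .$$
   Context: Constants: $\gamma>1$, mesh sizes $\Delta x,\Delta y,\Delta z>0$, time step $\Delta t>0$, small $\epsilon>0$ (e.g. $10^{-14}$). Indices $i,j,k$ range over all cells (including any cells needed by the stencil) of a uniform Cartesian mesh. States and admissible set: $\bm Q=(\rho,\bm m,E)^\top$ with $\rho,E\in\mathbb R$, $\bm m\in\mathbb R^3$, $\mathcal G=\{\bm Q:\rho>0,\ E-\frac{|\bm m|^2}{2\rho}>0\}$. Primitive variables $\bm W=(\rho,\bm v,p)^\top$: $\bm v=\bm m/\rho$, $p=(\gamma-1)\left(E-\frac{|\bm m|^2}{2\rho}\right)$; conversely $\bm m=\rho\bm v$, $E=\frac p{\gamma-1}+\frac12\rho|\bm v|^2$. Sound speed $c=\sqrt{\gamma p/\rho}$. Fluxes: $\bm G_\ell(\bm Q)=(m_\ell,\ m_\ell\bm v+p\,\mathbf e_\ell,\ (E+p)v_\ell)^\top$ and Lax--Friedrichs flux $\hat{\bm G}_\ell(\bm Q^-,\bm Q^+)=\frac12\left(\bm G_\ell(\bm Q^-)+\bm G_\ell(\bm Q^+)-\alpha_\ell(\bm Q^+-\bm Q^-)\right)$, $\ell=1,2,3$, where $\alpha_\ell=\||v_\ell|+c\|_{L^\infty}$; in particular $\alpha_\ell\ge|v_\ell|+c$ at every interface state $\widetilde{\bm Q}$ entering the scheme. Reconstruction: $\overline{\bm W}_{ijk}^n=(\overline\rho_{ijk}^n,\overline{\bm v}_{ijk}^n,\overline p_{ijk}^n)^\top$ are the primitive variables of $\overline{\bm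 Q}_{ijk}^n$. Slopes are componentwise van Albada: for a scalar component $W$ with backward and forward difference quotients $a=(\overline W_{ijk}^n-\overline W_{i-1,j,k}^n)/\Delta x$, $b=(\overline W_{i+1,j,k}^n-\overline W_{ijk}^n)/\Delta x$ and $\epsilon_x=3\Delta x$, $\delta W_{ijk}^x=\frac{(b^2+\epsilon_x)a+(a^2+\epsilon_x)b}{a^2+b^2+2\epsilon_x}$; $\delta W^y_{ijk}$, $\delta W^z_{ijk}$ are analogous in the $y$-, $z$-directions with $\epsilon_y=3\Delta y$, $\epsilon_z=3\Delta z$. For $\star\in\{x,y,z\}$, $(\Delta\rho_{ijk}^\star,\Delta\bm v_{ijk}^\star,\Delta p_{ijk}^\star)^\top=\frac{\Delta\star}{2}\delta\bm W_{ijk}^\star$. PP limiter with parameter $q>2$ (in each cell): let $S=\alpha_1\Delta y\Delta z+\alpha_2\Delta x\Delta z+\alpha_3\Delta x\Delta y$, $C_x=\alpha_1\Delta y\Delta z/S$, $C_y=\alpha_2\Delta x\Delta z/S$, $C_z=\alpha_3\Delta x\Delta y/S$. For $\star\in\{x,y,z\}$: $\alpha^\star=\min\left(\frac{\overline\rho_{ijk}^n}{|\Delta\rho_{ijk}^\star|(1+\epsilon)},1\right)$ if $\Delta\rho_{ijk}^\star\neq0$, else $1$; $\kappa^\star=\min\left(\frac{\overline p_{ijk}^n}{|\Delta p_{ijk}^\star|(1+\epsilon)},1\right)$ if $\Delta p_{ijk}^\star\ne0$, else $1$. If $|\Delta\bm v_{ijk}^x|+|\Delta\bm v_{ijk}^y|+|\Delta\bm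 v_{ijk}^z|\neq0$, $$\beta=\min\left(\sqrt{\frac{(q-2)^2\,\overline\rho_{ijk}^n\,\overline p_{ijk}^n}{(\gamma-1)\left(2A_1+(q-2)(\overline\rho_{ijk}^n)^2A_2\right)}},\,1\right),$$ $A_1=\left|C_x\alpha^x\Delta\rho_{ijk}^x\Delta\bm v_{ijk}^x+C_y\alpha^y\Delta\rho_{ijk}^y\Delta\bm v_{ijk}^y+C_z\alpha^z\Delta\rho_{ijk}^z\Delta\bm v_{ijk}^z\right|^2$, $A_2=C_x|\Delta\bm v_{ijk}^x|^2+C_y|\Delta\bm v_{ijk}^y|^2+C_z|\Delta\bm v_{ijk}^z|^2$; else $\beta=1$. The modified primitive limiting values are $\widetilde{\bm W}^{n,\mp}_{i\pm\frac12,j,k}=(\overline\rho_{ijk}^n\pm\alpha^x\Delta\rho_{ijk}^x,\ \overline{\bm v}_{ijk}^n\pm\beta\Delta\bm v_{ijk}^x,\ \overline p_{ijk}^n\pm\kappa^x\Delta p_{ijk}^x)^\top$, $\widetilde{\bm W}^{n,\mp}_{i,j\pm\frac12,k}=(\overline\rho_{ijk}^n\pm\alpha^y\Delta\rho_{ijk}^y,\ \overline{\bm v}_{ijk}^n\pm\beta\Delta\bm v_{ijk}^y,\ \overline p_{ijk}^n\pm\kappa^y\Delta p_{ijk}^y)^\top$, $\widetilde{\bm W}^{n,\mp}_{i,j,k\pm\frac12}=(\overline\rho_{ijk}^n\pm\alpha^z\Delta\rho_{ijk}^z,\ \overline{\bm v}_{ijk}^n\pm\beta\Delta\bm v_{ijk}^z,\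 \overline p_{ijk}^n\pm\kappa^z\Delta p_{ijk}^z)^\top$; $\widetilde{\bm Q}$ (same indices) is the conservative state with primitive variables $\widetilde{\bm W}$. *)

theory Defs
  imports "HOL-Analysis.Analysis"
begin

text \<open>
  A conservative state is \<open>(\<rho>, m, E)\<close>, a primitive state is \<open>(\<rho>, v, p)\<close>. The directions x, y, z are
  the elements 1, 2, 3 of the index type \<open>3\<close>, the mesh sizes are the components of a vector \<open>h\<close>,
  and the cell with indices i, j, k is a vector of type \<open>int ^ 3\<close>, so that \<open>c + axis l 1\<close> and
  \<open>c - axis l 1\<close> are the two neighbours of the cell \<open>c\<close> in direction \<open>l\<close>.
\<close>

type_synonym conserved = "real \<times> (real ^ 3) \<times> real"
type_synonym primitive = "real \<times> (real ^ 3) \<times> real"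
type_synonym cell = "int ^ 3"

abbreviation density :: "primitive \<Rightarrow> real"
  where "density W \<equiv> fst W"

abbreviation velocity :: "primitive \<Rightarrow> real ^ 3"
  where "velocity W \<equiv> fst (snd W)"

abbreviation pressure :: "primitive \<Rightarrow> real"
  where "pressure W \<equiv> snd (snd W)"

definition admissible :: "conserved set"
  where "admissible = {(\<rho>, m, E). \<rho> > 0 \<and> E - (norm m)\<^sup>2 / (2 * \<rho>) > 0}"

definition prim :: "real \<Rightarrow> conserved \<Rightarrow> primitive"
  where "prim \<gamma> = (\<lambda>(\<rho>, m, E). (\<rho>, m /\<^sub>R \<rho>, (\<gamma> - 1) * (E - (norm m)\<^sup>2 / (2 * \<rho>))))"

definition cons :: "real \<Rightarrow> primitive \<Rightarrow> conserved"
  where "cons \<gamma> = (\<lambda>(\<rho>, v, p). (\<rho>, \<rho> *\<^sub>R v, p / (\<gamma> - 1) + 1 / 2 * \<rho> * (norm v)\<^sup>2))"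

definition sound_speed :: "real \<Rightarrow> primitive \<Rightarrow> real"
  where "sound_speed \<gamma> W = sqrt (\<gamma> * pressure W / density W)"

definition flux :: "real \<Rightarrow> 3 \<Rightarrow> conserved \<Rightarrow> conserved"
  where "flux \<gamma> l = (\<lambda>(\<rho>, m, E).
    let v = velocity (prim \<gamma> (\<rho>, m, E)); p = pressure (prim \<gamma> (\<rho>, m, E))
    in (m $ l, (m $ l) *\<^sub>R v + p *\<^sub>R axis l 1, (E + p) * v $ l))"

definition lf_flux :: "real \<Rightarrow> real ^ 3 \<Rightarrow> 3 \<Rightarrow> conserved \<Rightarrow> conserved \<Rightarrow> conserved"
  where "lf_flux \<gamma> \<alpha> l Qm Qp =
    (1 / 2) *\<^sub>R (flux \<gamma> l Qm + flux \<gamma> l Qp - (\<alpha> $ l) *\<^sub>R (Qp - Qm))"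

definition van_albada :: "real \<Rightarrow> real \<Rightarrow> real \<Rightarrow> real"
  where "van_albada e a b =
    ((b\<^sup>2 + e) * a + (a\<^sup>2 + e) * b) / (a\<^sup>2 + b\<^sup>2 + 2 * e)"

definition slope :: "real ^ 3 \<Rightarrow> 3 \<Rightarrow> (cell \<Rightarrow> real) \<Rightarrow> cell \<Rightarrow> real"
  where "slope h l w c =
    van_albada (3 * h $ l)
      ((w c - w (c - axis l 1)) / h $ l)
      ((w (c + axis l 1) - w c) / h $ l)"

definition increment :: "real ^ 3 \<Rightarrow> 3 \<Rightarrow> (cell \<Rightarrow> real) \<Rightarrow> cell \<Rightarrow> real"
  where "increment h l w c = h $ l / 2 * slope h l w c"

definition d_rho :: "real ^ 3 \<Rightarrow> (cell \<Rightarrow> primitive) \<Rightarrow> 3 \<Rightarrow> cell \<Rightarrow> real"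
  where "d_rho h W l c = increment h l (\<lambda>c'. density (W c')) c"

definition d_v :: "real ^ 3 \<Rightarrow> (cell \<Rightarrow> primitive) \<Rightarrow> 3 \<Rightarrow> cell \<Rightarrow> real ^ 3"
  where "d_v h W l c = (\<chi> k. increment h l (\<lambda>c'. velocity (W c') $ k) c)"

definition d_p :: "real ^ 3 \<Rightarrow> (cell \<Rightarrow> primitive) \<Rightarrow> 3 \<Rightarrow> cell \<Rightarrow> real"
  where "d_p h W l c = increment h l (\<lambda>c'. pressure (W c')) c"

text \<open>
  \<open>scaling\<close> yields the factor of the density increment (first argument after \<open>\<epsilon>\<close> the mean
  density) as well as that of the pressure increment (mean pressure).
\<close>

definition scaling :: "real \<Rightarrow> real \<Rightarrow> real \<Rightarrow> real"
  where "scaling \<epsilon> a d = (if d \<noteq> 0 then min (a / (\<bar>d\<bar> * (1 + \<epsilon>))) 1 else 1)"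

definition rho_factor :: "real \<Rightarrow> real ^ 3 \<Rightarrow> (cell \<Rightarrow> primitive) \<Rightarrow> 3 \<Rightarrow> cell \<Rightarrow> real"
  where "rho_factor \<epsilon> h W l c = scaling \<epsilon> (density (W c)) (d_rho h W l c)"

definition p_factor :: "real \<Rightarrow> real ^ 3 \<Rightarrow> (cell \<Rightarrow> primitive) \<Rightarrow> 3 \<Rightarrow> cell \<Rightarrow> real"
  where "p_factor \<epsilon> h W l c = scaling \<epsilon> (pressure (W c)) (d_p h W l c)"

definition weight :: "real ^ 3 \<Rightarrow> real ^ 3 \<Rightarrow> 3 \<Rightarrow> real"
  where "weight h \<alpha> l =
    (\<alpha> $ l * (\<Prod>k \<in> UNIV - {l}. h $ k)) /
    (\<alpha> $ 1 * h $ 2 * h $ 3 + \<alpha> $ 2 * h $ 1 * h $ 3 + \<alpha> $ 3 * h $ 1 * h $ 2)"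

definition A1 :: "real \<Rightarrow> real ^ 3 \<Rightarrow> real ^ 3 \<Rightarrow> (cell \<Rightarrow> primitive) \<Rightarrow> cell \<Rightarrow> real"
  where "A1 \<epsilon> h \<alpha> W c =
    (norm (\<Sum>l\<in>UNIV. (weight h \<alpha> l * rho_factor \<epsilon> h W l c * d_rho h W l c) *\<^sub>R d_v h W l c))\<^sup>2"

definition A2 :: "real ^ 3 \<Rightarrow> real ^ 3 \<Rightarrow> (cell \<Rightarrow> primitive) \<Rightarrow> cell \<Rightarrow> real"
  where "A2 h \<alpha> W c = (\<Sum>l\<in>UNIV. weight h \<alpha> l * (norm (d_v h W l c))\<^sup>2)"

definition v_factor ::
  "real \<Rightarrow> real \<Rightarrow> real \<Rightarrow> real ^ 3 \<Rightarrow> real ^ 3 \<Rightarrow> (cell \<Rightarrow> primitive) \<Rightarrow> cell \<Rightarrow> real"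
  where "v_factor \<gamma> \<epsilon> q h \<alpha> W c =
    (if (\<Sum>l\<in>UNIV. norm (d_v h W l c)) \<noteq> 0
     then min (sqrt (((q - 2)\<^sup>2 * density (W c) * pressure (W c)) /
                     ((\<gamma> - 1) * (2 * A1 \<epsilon> h \<alpha> W c + (q - 2) * (density (W c))\<^sup>2 * A2 h \<alpha> W c)))) 1
     else 1)"

text \<open>
  The limited values of cell \<open>c\<close> at its two faces in direction \<open>l\<close>: \<open>s = 1\<close> is the face towards
  \<open>c + axis l 1\<close>, \<open>s = -1\<close> the face towards \<open>c - axis l 1\<close>.
\<close>

definition face_value ::
  "real \<Rightarrow> real \<Rightarrow> real \<Rightarrow> real ^ 3 \<Rightarrow> real ^ 3 \<Rightarrow> (cell \<Rightarrow> primitive) \<Rightarrow> real \<Rightarrow> 3 \<Rightarrow> cell \<Rightarrow> primitive"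
  where "face_value \<gamma> \<epsilon> q h \<alpha> W s l c =
    (density (W c) + s * (rho_factor \<epsilon> h W l c * d_rho h W l c),
     velocity (W c) + s *\<^sub>R (v_factor \<gamma> \<epsilon> q h \<alpha> W c *\<^sub>R d_v h W l c),
     pressure (W c) + s * (p_factor \<epsilon> h W l c * d_p h W l c))"

text \<open>
  The left and right limits (superscripts minus and plus) at the interface between \<open>c\<close> and
  \<open>c + axis l 1\<close>, i.e. at the half-index in direction \<open>l\<close> above \<open>c\<close>. The half-index below \<open>c\<close> is
  the interface of \<open>c - axis l 1\<close>. The argument \<open>Q\<close> is the field of conservative cell averages.
\<close>

definition Q_minus ::
  "real \<Rightarrow> real \<Rightarrow> real \<Rightarrow> real ^ 3 \<Rightarrow> real ^ 3 \<Rightarrow> (cell \<Rightarrow> conserved) \<Rightarrow> 3 \<Rightarrow> cell \<Rightarrow> conserved"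
  where "Q_minus \<gamma> \<epsilon> q h \<alpha> Q l c =
    cons \<gamma> (face_value \<gamma> \<epsilon> q h \<alpha> (\<lambda>c'. prim \<gamma> (Q c')) 1 l c)"

definition Q_plus ::
  "real \<Rightarrow> real \<Rightarrow> real \<Rightarrow> real ^ 3 \<Rightarrow> real ^ 3 \<Rightarrow> (cell \<Rightarrow> conserved) \<Rightarrow> 3 \<Rightarrow> cell \<Rightarrow> conserved"
  where "Q_plus \<gamma> \<epsilon> q h \<alpha> Q l c =
    cons \<gamma> (face_value \<gamma> \<epsilon> q h \<alpha> (\<lambda>c'. prim \<gamma> (Q c')) (- 1) l (c + axis l 1))"

text \<open>All interface states entering the update of the cells in \<open>M\<close>.\<close>

definition interface_states ::
  "real \<Rightarrow> real \<Rightarrow> real \<Rightarrow> real ^ 3 \<Rightarrow> real ^ 3 \<Rightarrow> (cell \<Rightarrow> conserved) \<Rightarrow> cell set \<Rightarrow> conserved set"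
  where "interface_states \<gamma> \<epsilon> q h \<alpha> Q M =
    (\<Union>c\<in>M. \<Union>l. \<Union>c'\<in>{c, c - axis l 1}. {Q_minus \<gamma> \<epsilon> q h \<alpha> Q l c', Q_plus \<gamma> \<epsilon> q h \<alpha> Q l c'})"

definition updated ::
  "real \<Rightarrow> real \<Rightarrow> real \<Rightarrow> real ^ 3 \<Rightarrow> real \<Rightarrow> real ^ 3 \<Rightarrow> (cell \<Rightarrow> conserved) \<Rightarrow> cell \<Rightarrow> conserved"
  where "updated \<gamma> \<epsilon> q h dt \<alpha> Q c =
    Q c - (\<Sum>l\<in>UNIV. (dt / h $ l) *\<^sub>R
      (lf_flux \<gamma> \<alpha> l (Q_minus \<gamma> \<epsilon> q h \<alpha> Q l c) (Q_plus \<gamma> \<epsilon> q h \<alpha> Q l c)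
       - lf_flux \<gamma> \<alpha> l (Q_minus \<gamma> \<epsilon> q h \<alpha> Q l (c - axis l 1)) (Q_plus \<gamma> \<epsilon> q h \<alpha> Q l (c - axis l 1))))"

end

(*
  A state lies in the admissible set iff its density is positive and, for every
  auxiliary velocity w, its energy E - m.w + rho |w|^2 / 2 in the frame moving with w is positive.
  Both conditions are linear in the state, so they can be tested on a linear splitting of the update.
  Writing G for the flux in direction l, and A, B for the two limited values of the cell
  at its faces in that direction, the identity
    -(alpha A + G A) = (alpha A - G A) - 2 alpha A
  (and its mirror image for B) turns the update into a positive combination of states
  alpha R + G R, alpha R - G R, which are admissible because alpha >= |v_l| + c, plus the remainder
    Q - (sum over l of (dt alpha_l / h_l) (A_l + B_l)).
  The velocity factor beta and the CFL condition are exactly what makes the remainder have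
  nonnegative energy in every moving frame.
*)

theory Submission
  imports Defs
begin

section \<open>Admissibility through linear functionals\<close>

definition moving_energy :: "real ^ 3 \<Rightarrow> conserved \<Rightarrow> real"
  where "moving_energy w = (\<lambda>(\<rho>, m, E). E - m \<bullet> w + \<rho> / 2 * (norm w)\<^sup>2)"

lemma linear_moving_energy: "linear (moving_energy w)"
  by (rule linearI) (auto simp: moving_energy_def inner_left_distrib algebra_simps add_divide_distrib)

text \<open>Completing the square in \<open>w\<close>: the internal energy is the minimum over all
  frames, attained at the state's own velocity.\<close>

lemma moving_energy_eq:
  assumes "\<rho> > 0"
  shows "moving_energy w (\<rho>, m, E) =
    E - (norm m)\<^sup>2 / (2 * \<rho>) + \<rho> / 2 * (norm (m /\<^sub>R \<rho> - w))\<^sup>2"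
proof -
  define v where "v = m /\<^sub>R \<rho>"
  have m: "m = \<rho> *\<^sub>R v" using assms by (simp add: v_def)
  have "(norm m)\<^sup>2 / (2 * \<rho>) = \<rho> / 2 * (v \<bullet> v)"
    using assms by (simp add: m power_mult_distrib power2_eq_square flip: power2_norm_eq_inner)
  moreover have "(norm (v - w))\<^sup>2 = v \<bullet> v - 2 * (v \<bullet> w) + w \<bullet> w"
    by (simp add: power2_norm_eq_inner inner_diff_left inner_diff_right inner_commute)
  moreover have "(norm w)\<^sup>2 = w \<bullet> w" by (rule power2_norm_eq_inner)
  ultimately show ?thesis
    unfolding v_def[symmetric] by (simp add: moving_energy_def m) (simp add: algebra_simps)
qed

lemma admissible_iff_moving_energy:
  "Q \<in> admissible \<longleftrightarrow> 0 < fst Q \<and> (\<forall>w. 0 < moving_energy w Q)"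
proof (cases Q)
  case (fields \<rho> m E)
  show ?thesis
  proof
    assume "Q \<in> admissible"
    then have "\<rho> > 0" "E - (norm m)\<^sup>2 / (2 * \<rho>) > 0"
      by (auto simp: admissible_def fields)
    then show "0 < fst Q \<and> (\<forall>w. 0 < moving_energy w Q)"
      unfolding fields by (auto simp only: moving_energy_eq fst_conv intro!: add_pos_nonneg) simp
  next
    assume *: "0 < fst Q \<and> (\<forall>w. 0 < moving_energy w Q)"
    \<comment> \<open>In the frame moving with the state itself only the internal energy
      remains.\<close>
    then have "\<rho> > 0" "0 < moving_energy (m /\<^sub>R \<rho>) (\<rho>, m, E)"
      by (auto simp: fields)
    then show "Q \<in> admissible"
      by (simp add: moving_energy_eq admissible_def fields)
  qed
qed

section \<open>Passing between primitive and conservative variables\<close>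

lemma prim_cons:
  assumes "\<gamma> > 1" and "density W > 0"
  shows "prim \<gamma> (cons \<gamma> W) = W"
proof (cases W)
  case (fields \<rho> v p)
  have "1 / 2 * \<rho> * (norm v)\<^sup>2 - (norm (\<rho> *\<^sub>R v))\<^sup>2 / (2 * \<rho>) = 0"
    using assms by (simp add: fields power_mult_distrib power2_eq_square)
  then show ?thesis
    using assms by (simp add: fields prim_def cons_def)
qed

lemma cons_prim:
  assumes "\<gamma> > 1" and "fst Q > 0"
  shows "cons \<gamma> (prim \<gamma> Q) = Q"
proof (cases Q)
  case (fields \<rho> m E)
  define v where "v = m /\<^sub>R \<rho>"
  have m: "m = \<rho> *\<^sub>R v" using assms by (simp add: v_def fields)
  have "1 / 2 * \<rho> * (norm v)\<^sup>2 = (norm m)\<^sup>2 / (2 * \<rho>)"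
    using assms by (simp add: m fields power_mult_distrib power2_eq_square)
  then show ?thesis
    using assms m by (simp add: fields prim_def cons_def flip: v_def)
qed

lemma fst_cons [simp]: "fst (cons \<gamma> W) = density W"
  by (cases W) (simp add: cons_def)

lemma moving_energy_cons:
  "moving_energy w (cons \<gamma> W) =
    pressure W / (\<gamma> - 1) + density W / 2 * (norm (velocity W - w))\<^sup>2"
proof (cases W)
  case (fields \<rho> v p)
  have "(norm (v - w))\<^sup>2 = (norm v)\<^sup>2 - 2 * (v \<bullet> w) + (norm w)\<^sup>2"
    by (simp add: power2_norm_eq_inner inner_diff_left inner_diff_right inner_commute)
  then have "\<rho> / 2 * (norm (v - w))\<^sup>2 =
      \<rho> / 2 * (norm v)\<^sup>2 - \<rho> * (v \<bullet> w) + \<rho> / 2 * (norm w)\<^sup>2"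
    by (simp only: distrib_left right_diff_distrib)
  then show ?thesis
    by (simp add: fields moving_energy_def cons_def)
qed

lemma prim_positive:
  assumes "\<gamma> > 1" and "Q \<in> admissible"
  shows "density (prim \<gamma> Q) > 0" and "pressure (prim \<gamma> Q) > 0"
  using assms by (auto simp: prim_def admissible_def)

section \<open>Positivity of the flux splitting\<close>

lemma flux_cons:
  assumes "\<gamma> > 1" and "\<rho> > 0"
  shows "flux \<gamma> l (cons \<gamma> (\<rho>, v, p)) =
    (\<rho> * v $ l, (\<rho> * v $ l) *\<^sub>R v + p *\<^sub>R axis l 1,
     (p / (\<gamma> - 1) + 1 / 2 * \<rho> * (norm v)\<^sup>2 + p) * v $ l)"
proof -
  have "prim \<gamma> (\<rho>, \<rho> *\<^sub>R v, p / (\<gamma> - 1) + 1 / 2 * \<rho> * (norm v)\<^sup>2) = (\<rho>, v, p)"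
    using prim_cons[of \<gamma> "(\<rho>, v, p)"] assms by (simp add: cons_def)
  then show ?thesis
    by (simp add: flux_def cons_def Let_def)
qed

text \<open>The speed bound keeps \<open>u = a + s * v $ l\<close> at or above the sound speed for
  both signs of \<open>s\<close>. The density becomes \<open>\<rho> * u\<close>, and the moving
  energy is bounded below by a quadratic in one scalar with negative discriminant.\<close>

lemma split_flux_positive:
  fixes W :: primitive
  assumes "\<gamma> > 1" and "density W > 0" and "pressure W > 0"
    and speed: "\<bar>velocity W $ l\<bar> + sound_speed \<gamma> W \<le> a"
    and s: "\<bar>s\<bar> = 1"
  shows "0 < fst (a *\<^sub>R cons \<gamma> W + s *\<^sub>R flux \<gamma> l (cons \<gamma> W))"
    and "0 < moving_energy w (a *\<^sub>R cons \<gamma> W + s *\<^sub>R flux \<gamma> l (cons \<gamma> W))"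
proof -
  obtain \<rho> v p where W: "W = (\<rho>, v, p)" by (cases W)
  have pos: "\<rho> > 0" "p > 0" using assms W by auto
  define u where "u = a + s * v $ l"
  define c where "c = sound_speed \<gamma> W"
  define d where "d = v $ l - w $ l"
  have c: "c > 0" "c\<^sup>2 = \<gamma> * p / \<rho>"
    using assms pos by (auto simp: c_def sound_speed_def W)
  have "\<bar>s * v $ l\<bar> = \<bar>v $ l\<bar>" using s by (simp add: abs_mult)
  then have u: "u \<ge> c" using speed by (simp add: u_def c_def W)
  then have u0: "u > 0" using c by simp
  have "fst (a *\<^sub>R cons \<gamma> W + s *\<^sub>R flux \<gamma> l (cons \<gamma> W)) = \<rho> * u"
    using assms pos by (simp add: W flux_cons u_def algebra_simps)
  then show "0 < fst (a *\<^sub>R cons \<gamma> W + s *\<^sub>R flux \<gamma> l (cons \<gamma> W))"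
    using pos u0 by simp
  \<comment> \<open>The flux transports the moving energy with speed \<open>v $ l\<close>; the
    pressure contributes the extra term \<open>p * d\<close>, where \<open>d\<close> is the velocity
    relative to the frame in direction \<open>l\<close>.\<close>
  have eq: "moving_energy w (a *\<^sub>R cons \<gamma> W + s *\<^sub>R flux \<gamma> l (cons \<gamma> W)) =
      u * (p / (\<gamma> - 1) + \<rho> / 2 * (norm (v - w))\<^sup>2) + s * p * d"
    using assms pos
    by (simp add: W flux_cons linear_add[OF linear_moving_energy]
        linear_scale[OF linear_moving_energy] moving_energy_cons)
      (simp add: moving_energy_def u_def d_def power2_norm_eq_inner inner_diff_left
        inner_diff_right inner_commute[of w v] inner_axis' inner_left_distrib
        algebra_simps add_divide_distrib diff_divide_distrib)
  have "\<bar>d\<bar> \<le> norm (v - w)"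
    using component_le_norm_cart[of "v - w" l] by (simp add: d_def)
  then have dn: "d\<^sup>2 \<le> (norm (v - w))\<^sup>2"
    using abs_le_square_iff[of d "norm (v - w)"] by simp
  \<comment> \<open>Dropping the components of \<open>v - w\<close> other than the
    \<open>l\<close>-th reduces the claim to a quadratic in \<open>d\<close>.\<close>
  have "u * (p / (\<gamma> - 1) + \<rho> / 2 * d\<^sup>2) \<le> u * (p / (\<gamma> - 1) + \<rho> / 2 * (norm (v - w))\<^sup>2)"
    using u0 pos dn by (intro mult_left_mono add_left_mono) auto
  moreover have "0 < u * (p / (\<gamma> - 1) + \<rho> / 2 * d\<^sup>2) + s * p * d"
  proof -
    have "s\<^sup>2 = 1" using s by (simp add: abs_square_eq_1)
    \<comment> \<open>Since \<open>c\<close> is the sound speed, this amounts to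
      \<open>\<gamma> - 1 < 2 * \<gamma>\<close>. Combined with \<open>u \<ge> c\<close> it is the
      discriminant condition.\<close>
    have "(\<gamma> - 1) * p < 2 * \<rho> * c\<^sup>2"
    proof -
      have "\<rho> * c\<^sup>2 = \<gamma> * p" using c pos by simp
      moreover have "0 < \<gamma> * p" using pos assms(1) by simp
      ultimately show ?thesis using pos by (simp add: left_diff_distrib)
    qed
    also have "\<dots> \<le> 2 * \<rho> * u\<^sup>2"
      using u c pos by (intro mult_left_mono power_mono) auto
    finally have "(\<gamma> - 1) * p\<^sup>2 < 2 * \<rho> * u\<^sup>2 * p"
      using pos by (simp add: power2_eq_square)
    then have "p\<^sup>2 < 2 * \<rho> * u\<^sup>2 * p / (\<gamma> - 1)"
      using assms(1) by (simp add: field_simps)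
    \<comment> \<open>Completing the square in \<open>d\<close> after multiplying by the positive
      factor \<open>2 * \<rho> * u\<close>.\<close>
    moreover have "2 * \<rho> * u * (u * (p / (\<gamma> - 1) + \<rho> / 2 * d\<^sup>2) + s * p * d)
        = (\<rho> * u * d + s * p)\<^sup>2 + (2 * \<rho> * u\<^sup>2 * p / (\<gamma> - 1) - s\<^sup>2 * p\<^sup>2)"
      by (simp add: power2_eq_square algebra_simps)
    ultimately have "0 < 2 * \<rho> * u * (u * (p / (\<gamma> - 1) + \<rho> / 2 * d\<^sup>2) + s * p * d)"
      using \<open>s\<^sup>2 = 1\<close> by (simp add: add_nonneg_pos)
    then show ?thesis
      by (rule zero_less_mult_pos) (simp add: pos u0)
  qed
  ultimately show "0 < moving_energy w (a *\<^sub>R cons \<gamma> W + s *\<^sub>R flux \<gamma> l (cons \<gamma> W))"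
    unfolding eq by linarith
qed

section \<open>Consequences of the limiter factors\<close>

text \<open>The factor \<open>1 + \<epsilon>\<close> caps the scaled increment at
  \<open>a / (1 + \<epsilon>)\<close>, strictly below the mean. This strictness keeps the limited
  densities and pressures positive.\<close>

lemma abs_scaling_less:
  assumes "a > 0" and "\<epsilon> > 0"
  shows "\<bar>scaling \<epsilon> a d * d\<bar> < a"
proof (cases "d = 0")
  case False
  have "\<bar>scaling \<epsilon> a d * d\<bar> = scaling \<epsilon> a d * \<bar>d\<bar>"
    using assms False by (simp add: scaling_def abs_mult)
  also have "\<dots> \<le> a / (\<bar>d\<bar> * (1 + \<epsilon>)) * \<bar>d\<bar>"
    using False by (intro mult_right_mono) (auto simp: scaling_def)
  also have "\<dots> = a / (1 + \<epsilon>)" using False by simp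
  also have "\<dots> < a" using assms by (simp add: field_simps)
  finally show ?thesis .
qed (use assms in simp)

lemma face_value_positive:
  assumes "\<epsilon> > 0" and "density (W c) > 0" and "pressure (W c) > 0" and "\<bar>s\<bar> = 1"
  shows "density (face_value \<gamma> \<epsilon> q h \<alpha> W s l c) > 0"
    and "pressure (face_value \<gamma> \<epsilon> q h \<alpha> W s l c) > 0"
proof -
  have "\<bar>s * (scaling \<epsilon> a d * d)\<bar> < a" if "a > 0" for a d
    using abs_scaling_less[OF that assms(1), of d] assms(4) by (simp add: abs_mult)
  then have "a + s * (scaling \<epsilon> a d * d) > 0" if "a > 0" for a d
    using that by (smt (verit))
  then show "density (face_value \<gamma> \<epsilon> q h \<alpha> W s l c) > 0"
    and "pressure (face_value \<gamma> \<epsilon> q h \<alpha> W s l c) > 0"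
    using assms by (simp_all add: face_value_def rho_factor_def p_factor_def)
qed

text \<open>Squaring the definition of the velocity factor and clearing the denominator puts the
  limiter into the form in which the energy estimate consumes it.\<close>

lemma v_factor_bound:
  assumes "\<gamma> > 1" and "q > 2" and "density (W c) > 0" and "pressure (W c) > 0"
    and A2_nonneg: "A2 h \<alpha> W c \<ge> 0"
  shows "(v_factor \<gamma> \<epsilon> q h \<alpha> W c)\<^sup>2 *
      (2 * A1 \<epsilon> h \<alpha> W c + (q - 2) * (density (W c))\<^sup>2 * A2 h \<alpha> W c)
    \<le> (q - 2)\<^sup>2 * (density (W c) * pressure (W c) / (\<gamma> - 1))"
proof -
  define D where "D = 2 * A1 \<epsilon> h \<alpha> W c + (q - 2) * (density (W c))\<^sup>2 * A2 h \<alpha> W c"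
  define N where "N = (q - 2)\<^sup>2 * density (W c) * pressure (W c)"
  define \<beta> where "\<beta> = v_factor \<gamma> \<epsilon> q h \<alpha> W c"
  have D0: "D \<ge> 0"
    unfolding D_def using assms A2_nonneg by (intro add_nonneg_nonneg) (auto simp: A1_def)
  have N0: "N \<ge> 0"
    unfolding N_def using assms by auto
  have "\<beta>\<^sup>2 * D \<le> N / (\<gamma> - 1)"
  proof (cases "D = 0")
    \<comment> \<open>The quotient under the root has denominator zero here, but the left side
      vanishes whatever the value of \<open>\<beta>\<close>.\<close>
    case True
    then show ?thesis using N0 assms by simp
  next
    case False
    \<comment> \<open>If all velocity increments vanished, \<open>A1\<close> and \<open>A2\<close>
      would too; hence the branch with the square root applies.\<close>
    then have "(\<Sum>l\<in>UNIV. norm (d_v h W l c)) \<noteq> 0"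
      by (intro notI) (simp add: D_def A1_def A2_def sum_nonneg_eq_0_iff)
    then have "\<beta> = min (sqrt (N / ((\<gamma> - 1) * D))) 1"
      by (simp add: \<beta>_def v_factor_def N_def D_def)
    moreover have nn: "0 \<le> N / ((\<gamma> - 1) * D)" using D0 N0 assms by simp
    ultimately have "0 \<le> \<beta>" "\<beta> \<le> sqrt (N / ((\<gamma> - 1) * D))" by auto
    then have "\<beta>\<^sup>2 \<le> N / ((\<gamma> - 1) * D)"
      using power_mono[of \<beta> "sqrt (N / ((\<gamma> - 1) * D))" 2] nn by simp
    then have "\<beta>\<^sup>2 * D \<le> N / ((\<gamma> - 1) * D) * D" using D0 by (rule mult_right_mono)
    then show ?thesis using False by simp
  qed
  then show ?thesis by (simp add: \<beta>_def D_def N_def mult.assoc)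
qed

text \<open>The expression is a quadratic in \<open>u\<close> with leading coefficient
  \<open>(1 - 2 * \<theta>) * \<rho> / 2 > 0\<close>. Its minimum is nonnegative exactly under an
  inequality that the limiter supplies once
  \<open>\<theta> * (q - 2) \<le> 1 - 2 * \<theta>\<close>, which is the CFL bound
  rewritten.\<close>

lemma limited_energy_nonneg:
  fixes u g :: "'a :: real_inner"
  assumes \<theta>: "0 < \<theta>" "\<theta> \<le> 1 / q" and "q > 2" and "\<rho> > 0" and "e \<ge> 0" and "K \<ge> 0"
    and limiter: "\<beta>\<^sup>2 * (2 * (norm g)\<^sup>2 + (q - 2) * \<rho>\<^sup>2 * K) \<le> (q - 2)\<^sup>2 * (\<rho> * e)"
  shows "0 \<le> (1 - 2 * \<theta>) * (e + \<rho> / 2 * (norm u)\<^sup>2) - \<theta> * \<beta>\<^sup>2 * \<rho> * K - 2 * \<theta> * \<beta> * (u \<bullet> g)"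
proof -
  define s where "s = q - 2"
  define k where "k = 1 - 2 * \<theta>"
  have s: "s > 0" using assms by (simp add: s_def)
  have "\<theta> * q \<le> 1" using assms by (simp add: field_simps)
  then have ks: "\<theta> * s \<le> k" by (simp add: s_def k_def algebra_simps)
  then have k: "k > 0" using s \<theta> by (smt (verit) mult_pos_pos)
  have "2 * \<theta>\<^sup>2 * \<beta>\<^sup>2 * (norm g)\<^sup>2 + \<theta> * k * \<beta>\<^sup>2 * \<rho>\<^sup>2 * K \<le> k\<^sup>2 * (\<rho> * e)"
  proof -
    \<comment> \<open>Multiplying by the square of \<open>s\<close> pairs each
      \<open>\<theta>\<close> with an \<open>s\<close>, so that every \<open>\<theta> * s\<close>
      can be replaced by \<open>k\<close> and the limiter bound appears.\<close>
    have "s\<^sup>2 * (2 * \<theta>\<^sup>2 * \<beta>\<^sup>2 * (norm g)\<^sup>2 + \<theta> * k * \<beta>\<^sup>2 * \<rho>\<^sup>2 * K)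
        = (\<theta> * s) * (\<theta> * s) * (2 * \<beta>\<^sup>2 * (norm g)\<^sup>2) + (\<theta> * s) * k * (s * \<beta>\<^sup>2 * \<rho>\<^sup>2 * K)"
      by (simp add: power2_eq_square algebra_simps)
    also have "\<dots> \<le> k * k * (2 * \<beta>\<^sup>2 * (norm g)\<^sup>2) + k * k * (s * \<beta>\<^sup>2 * \<rho>\<^sup>2 * K)"
      using ks k s \<theta> assms by (intro add_mono mult_right_mono mult_mono) auto
    also have "\<dots> = k\<^sup>2 * (\<beta>\<^sup>2 * (2 * (norm g)\<^sup>2 + s * \<rho>\<^sup>2 * K))"
      by (simp add: power2_eq_square algebra_simps)
    also have "\<dots> \<le> k\<^sup>2 * (s\<^sup>2 * (\<rho> * e))"
      using limiter by (intro mult_left_mono) (auto simp: s_def)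
    finally have "s\<^sup>2 * (2 * \<theta>\<^sup>2 * \<beta>\<^sup>2 * (norm g)\<^sup>2 + \<theta> * k * \<beta>\<^sup>2 * \<rho>\<^sup>2 * K) \<le> s\<^sup>2 * (k\<^sup>2 * (\<rho> * e))"
      by (simp add: mult.left_commute)
    then show ?thesis using s by simp
  qed
  \<comment> \<open>Completing the square in \<open>u\<close>; the remaining bracket is the
    inequality just proved.\<close>
  moreover have "\<rho> * k * (k * (e + \<rho> / 2 * (norm u)\<^sup>2) - \<theta> * \<beta>\<^sup>2 * \<rho> * K - 2 * \<theta> * \<beta> * (u \<bullet> g))
     = (norm ((\<rho> * k) *\<^sub>R u - (2 * \<theta> * \<beta>) *\<^sub>R g))\<^sup>2 / 2
       + (k\<^sup>2 * (\<rho> * e) - (2 * \<theta>\<^sup>2 * \<beta>\<^sup>2 * (norm g)\<^sup>2 + \<theta> * k * \<beta>\<^sup>2 * \<rho>\<^sup>2 * K))"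
    unfolding power2_norm_eq_inner
    by (simp add: inner_diff_left inner_diff_right inner_commute[of g u] power2_eq_square field_simps)
  ultimately have "0 \<le> \<rho> * k * (k * (e + \<rho> / 2 * (norm u)\<^sup>2) - \<theta> * \<beta>\<^sup>2 * \<rho> * K - 2 * \<theta> * \<beta> * (u \<bullet> g))"
    by simp
  then show ?thesis
    using mult_le_cancel_left_pos[of "\<rho> * k" 0] assms(4) k by (simp add: k_def)
qed

section \<open>Limiter weights and the CFL number\<close>

text \<open>Dividing numerator and denominator of the weight by the cell volume shows that it is
  \<open>\<alpha> $ l / h $ l\<close> normalised by the sum over the directions.\<close>

lemma CFL_weight:
  fixes h \<alpha> :: "real ^ 3"
  assumes "\<And>l. h $ l > 0" and "\<And>l. \<alpha> $ l > 0"
  shows "dt * (\<alpha> $ 1 / h $ 1 + \<alpha> $ 2 / h $ 2 + \<alpha> $ 3 / h $ 3) * weight h \<alpha> l = dt / h $ l * \<alpha> $ l"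
proof -
  define S where "S = \<alpha> $ 1 * h $ 2 * h $ 3 + \<alpha> $ 2 * h $ 1 * h $ 3 + \<alpha> $ 3 * h $ 1 * h $ 2"
  have S: "S > 0" using assms unfolding S_def by (intro add_pos_pos mult_pos_pos) auto
  have h: "h $ k \<noteq> 0" for k using assms(1)[of k] by simp
  have "\<alpha> $ 1 / h $ 1 + \<alpha> $ 2 / h $ 2 + \<alpha> $ 3 / h $ 3 = S / (\<Prod>k\<in>UNIV. h $ k)"
  proof -
    have "(\<Prod>k\<in>UNIV. h $ k) = h $ 1 * h $ 2 * h $ 3" unfolding UNIV_3 by simp
    moreover have "a / x + b / y + c / z = (a * y * z + b * x * z + c * x * y) / (x * y * z)"
      if "x \<noteq> 0" "y \<noteq> 0" "z \<noteq> 0" for a b c x y z :: real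
      using that by (simp add: field_simps)
    ultimately show ?thesis using h by (simp add: S_def)
  qed
  moreover have "weight h \<alpha> l = \<alpha> $ l * (\<Prod>k\<in>UNIV - {l}. h $ k) / S"
    by (simp add: weight_def S_def)
  moreover have "(\<Prod>k\<in>UNIV. h $ k) = h $ l * (\<Prod>k\<in>UNIV - {l}. h $ k)"
    by (rule prod.remove) auto
  moreover have "(\<Prod>k\<in>UNIV - {l}. h $ k) \<noteq> 0" using h by simp
  ultimately show ?thesis using S by simp
qed

lemma sum_weight:
  fixes h \<alpha> :: "real ^ 3"
  assumes "\<And>l. h $ l > 0" and "\<And>l. \<alpha> $ l > 0"
  shows "(\<Sum>l\<in>UNIV. weight h \<alpha> l) = 1"
proof -
  define T where "T = \<alpha> $ 1 / h $ 1 + \<alpha> $ 2 / h $ 2 + \<alpha> $ 3 / h $ 3"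
  have "T > 0" using assms unfolding T_def by (intro add_pos_pos divide_pos_pos) auto
  moreover have "T * (\<Sum>l\<in>UNIV. weight h \<alpha> l) = T"
    \<comment> \<open>With time step 1 the weights times \<open>T\<close> are the summands of
      \<open>T\<close>.\<close>
    using CFL_weight[OF assms, of 1] by (simp only: T_def sum_distrib_left) (simp add: sum_3)
  ultimately show ?thesis by simp
qed

section \<open>Energy of the remainder\<close>

text \<open>Opposite faces carry opposite increments, so all odd terms cancel, the pressure
  increment included. What survives is twice the cell energy, a term quadratic in the velocity
  increment, and the mixed density-velocity term.\<close>

lemma moving_energy_face_values:
  fixes h \<alpha> :: "real ^ 3" and W :: "cell \<Rightarrow> primitive"
    and \<gamma> \<epsilon> q :: real and c :: cell
  defines "F \<equiv> \<lambda>s l. cons \<gamma> (face_value \<gamma> \<epsilon> q h \<alpha> W s l c)"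
  shows "moving_energy w (F 1 l) + moving_energy w (F (- 1) l) =
    2 * (pressure (W c) / (\<gamma> - 1) + density (W c) / 2 * (norm (velocity (W c) - w))\<^sup>2)
    + density (W c) * (v_factor \<gamma> \<epsilon> q h \<alpha> W c)\<^sup>2 * (norm (d_v h W l c))\<^sup>2
    + 2 * (v_factor \<gamma> \<epsilon> q h \<alpha> W c) *
        ((velocity (W c) - w) \<bullet> ((rho_factor \<epsilon> h W l c * d_rho h W l c) *\<^sub>R d_v h W l c))"
proof -
  define z where "z = velocity (W c) - w"
  define x where "x = v_factor \<gamma> \<epsilon> q h \<alpha> W c *\<^sub>R d_v h W l c"
  define \<delta> where "\<delta> = rho_factor \<epsilon> h W l c * d_rho h W l c"
  define \<pi> where "\<pi> = p_factor \<epsilon> h W l c * d_p h W l c"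
  have z: "velocity (W c) + x - w = z + x" "velocity (W c) - x - w = z - x"
    by (simp_all add: z_def)
  have "moving_energy w (F 1 l) =
      (pressure (W c) + \<pi>) / (\<gamma> - 1) + (density (W c) + \<delta>) / 2 * (norm (z + x))\<^sup>2"
    by (simp add: F_def moving_energy_cons face_value_def z flip: x_def \<delta>_def \<pi>_def)
  moreover have "moving_energy w (F (- 1) l) =
      (pressure (W c) - \<pi>) / (\<gamma> - 1) + (density (W c) - \<delta>) / 2 * (norm (z - x))\<^sup>2"
    by (simp add: F_def moving_energy_cons face_value_def z flip: x_def \<delta>_def \<pi>_def)
  moreover have "(density (W c) + \<delta>) / 2 * (norm (z + x))\<^sup>2
      + (density (W c) - \<delta>) / 2 * (norm (z - x))\<^sup>2 =
      2 * (density (W c) / 2 * (norm z)\<^sup>2) + density (W c) * (norm x)\<^sup>2 + 2 * \<delta> * (z \<bullet> x)"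
    by (simp add: power2_norm_eq_inner inner_diff_left inner_diff_right inner_left_distrib
        inner_right_distrib inner_commute[of x z] field_simps)
  moreover have "(pressure (W c) + \<pi>) / (\<gamma> - 1) + (pressure (W c) - \<pi>) / (\<gamma> - 1) =
      2 * (pressure (W c) / (\<gamma> - 1))"
    by (simp add: add_divide_distrib diff_divide_distrib)
  moreover have "density (W c) * (norm x)\<^sup>2 =
      density (W c) * (v_factor \<gamma> \<epsilon> q h \<alpha> W c)\<^sup>2 * (norm (d_v h W l c))\<^sup>2"
    by (simp add: x_def power_mult_distrib)
  moreover have "2 * \<delta> * (z \<bullet> x) = 2 * v_factor \<gamma> \<epsilon> q h \<alpha> W c *
      (z \<bullet> ((rho_factor \<epsilon> h W l c * d_rho h W l c) *\<^sub>R d_v h W l c))"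
    by (simp add: x_def \<delta>_def)
  ultimately have "moving_energy w (F 1 l) + moving_energy w (F (- 1) l) =
      2 * (pressure (W c) / (\<gamma> - 1)) + (2 * (density (W c) / 2 * (norm z)\<^sup>2)
      + density (W c) * (v_factor \<gamma> \<epsilon> q h \<alpha> W c)\<^sup>2 * (norm (d_v h W l c))\<^sup>2
      + 2 * v_factor \<gamma> \<epsilon> q h \<alpha> W c *
        (z \<bullet> ((rho_factor \<epsilon> h W l c * d_rho h W l c) *\<^sub>R d_v h W l c)))"
    by (smt (verit, del_insts))
  then show ?thesis
    unfolding z_def[symmetric] distrib_left by (simp only: add.assoc)
qed

text \<open>Averaging the face energies over the directions with the limiter weights produces
  \<open>A2\<close> from the quadratic terms and the vector \<open>g\<close> from the mixed ones,
  where the squared norm of \<open>g\<close> is \<open>A1\<close>. The claim is then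
  \<open>limited_energy_nonneg\<close> with \<open>K\<close> equal to \<open>A2\<close>.\<close>

lemma remainder_energy_nonneg:
  fixes h \<alpha> :: "real ^ 3" and W :: "cell \<Rightarrow> primitive"
    and \<gamma> \<epsilon> q dt :: real and c :: cell
  assumes "\<gamma> > 1" and "q > 2" and "dt > 0" and h: "\<And>l. h $ l > 0" and \<alpha>: "\<And>l. \<alpha> $ l > 0"
    and W: "density (W c) > 0" "pressure (W c) > 0"
    and CFL: "dt * (\<alpha> $ 1 / h $ 1 + \<alpha> $ 2 / h $ 2 + \<alpha> $ 3 / h $ 3) \<le> 1 / q"
  defines "F \<equiv> \<lambda>s l. cons \<gamma> (face_value \<gamma> \<epsilon> q h \<alpha> W s l c)"
  shows "(\<Sum>l\<in>UNIV. dt / h $ l * \<alpha> $ l * (moving_energy w (F 1 l) + moving_energy w (F (- 1) l)))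
    \<le> moving_energy w (cons \<gamma> (W c))"
proof -
  define \<theta> where "\<theta> = dt * (\<alpha> $ 1 / h $ 1 + \<alpha> $ 2 / h $ 2 + \<alpha> $ 3 / h $ 3)"
  define C where "C = weight h \<alpha>"
  define \<beta> where "\<beta> = v_factor \<gamma> \<epsilon> q h \<alpha> W c"
  define g where "g = (\<Sum>l\<in>UNIV. (C l * rho_factor \<epsilon> h W l c * d_rho h W l c) *\<^sub>R d_v h W l c)"
  define u where "u = velocity (W c) - w"
  define e where "e = pressure (W c) / (\<gamma> - 1)"
  have \<theta>: "\<theta> > 0"
    unfolding \<theta>_def using assms(3) h \<alpha> by (intro mult_pos_pos add_pos_pos divide_pos_pos) auto
  have \<theta>C: "\<theta> * C l = dt / h $ l * \<alpha> $ l" for l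
    unfolding \<theta>_def C_def by (rule CFL_weight[OF h \<alpha>])
  have C: "C l \<ge> 0" for l
  proof -
    have "0 \<le> \<theta> * C l" unfolding \<theta>C using \<alpha>[of l] h[of l] assms(3) by simp
    then show ?thesis using \<theta> by (simp add: zero_le_mult_iff)
  qed
  then have A2: "A2 h \<alpha> W c \<ge> 0"
    unfolding A2_def by (intro sum_nonneg mult_nonneg_nonneg) (auto simp: C_def)
  have "0 \<le> (1 - 2 * \<theta>) * (e + density (W c) / 2 * (norm u)\<^sup>2)
      - \<theta> * \<beta>\<^sup>2 * density (W c) * A2 h \<alpha> W c - 2 * \<theta> * \<beta> * (u \<bullet> g)"
    using v_factor_bound[OF assms(1,2) W A2, of \<epsilon>] CFL \<theta> assms(1,2) W A2
    by (intro limited_energy_nonneg[where q = q]) (auto simp: e_def \<theta>_def g_def \<beta>_def A1_def C_def)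
  also have "\<dots> = (e + density (W c) / 2 * (norm u)\<^sup>2) -
      \<theta> * (2 * (e + density (W c) / 2 * (norm u)\<^sup>2) + density (W c) * \<beta>\<^sup>2 * A2 h \<alpha> W c
        + 2 * \<beta> * (u \<bullet> g))"
    by (simp add: algebra_simps add_divide_distrib diff_divide_distrib)
  \<comment> \<open>The weights sum to 1, and \<open>\<beta>\<close> is common to all three
    directions and factors out of the sums.\<close>
  also have "2 * (e + density (W c) / 2 * (norm u)\<^sup>2) + density (W c) * \<beta>\<^sup>2 * A2 h \<alpha> W c
        + 2 * \<beta> * (u \<bullet> g) =
      (\<Sum>l\<in>UNIV. C l * (2 * (e + density (W c) / 2 * (norm u)\<^sup>2)
        + density (W c) * \<beta>\<^sup>2 * (norm (d_v h W l c))\<^sup>2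
        + 2 * \<beta> * (u \<bullet> ((rho_factor \<epsilon> h W l c * d_rho h W l c) *\<^sub>R d_v h W l c))))"
  proof -
    have "(\<Sum>l\<in>UNIV. C l * (2 * (e + density (W c) / 2 * (norm u)\<^sup>2))) =
        2 * (e + density (W c) / 2 * (norm u)\<^sup>2)"
      using sum_weight[OF h \<alpha>] by (simp add: C_def flip: sum_distrib_right)
    moreover have "(\<Sum>l\<in>UNIV. C l * (density (W c) * \<beta>\<^sup>2 * (norm (d_v h W l c))\<^sup>2)) =
        density (W c) * \<beta>\<^sup>2 * A2 h \<alpha> W c"
      by (simp add: A2_def C_def sum_distrib_left mult_ac)
    moreover have "(\<Sum>l\<in>UNIV. C l *
          (2 * \<beta> * (u \<bullet> ((rho_factor \<epsilon> h W l c * d_rho h W l c) *\<^sub>R d_v h W l c)))) =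
        2 * \<beta> * (u \<bullet> g)"
      by (simp add: g_def inner_sum_right sum_distrib_left mult_ac)
    ultimately show ?thesis by (simp add: distrib_left sum.distrib)
  qed
  also have "\<theta> * \<dots> = (\<Sum>l\<in>UNIV. dt / h $ l * \<alpha> $ l *
      (moving_energy w (F 1 l) + moving_energy w (F (- 1) l)))"
    unfolding F_def moving_energy_face_values
    by (simp add: sum_distrib_left \<beta>_def u_def e_def mult.assoc[symmetric] \<theta>C)
  finally show ?thesis
    by (simp add: moving_energy_cons e_def u_def)
qed

section \<open>Assembling the update\<close>

text \<open>Stated for an arbitrary linear functional so that one splitting serves both the density
  and every moving energy.\<close>

lemma linear_update_positive:
  fixes f :: "conserved \<Rightarrow> real"
  assumes f: "linear f" and "dt > 0" and h: "\<And>l. h $ l > 0"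
    and split: "\<And>R s l. \<lbrakk>R \<in> interface_states \<gamma> \<epsilon> q h \<alpha> Q {c}; \<bar>s\<bar> = 1\<rbrakk> \<Longrightarrow>
      0 < f (\<alpha> $ l *\<^sub>R R + s *\<^sub>R flux \<gamma> l R)"
    and remainder: "(\<Sum>l\<in>UNIV. dt / h $ l * \<alpha> $ l *
      (f (Q_minus \<gamma> \<epsilon> q h \<alpha> Q l c) + f (Q_plus \<gamma> \<epsilon> q h \<alpha> Q l (c - axis l 1)))) \<le> f (Q c)"
  shows "0 < f (updated \<gamma> \<epsilon> q h dt \<alpha> Q c)"
proof -
  note lin = linear_add[OF f] linear_diff[OF f] linear_scale[OF f] linear_sum[OF f]
  let ?A = "\<lambda>l. Q_minus \<gamma> \<epsilon> q h \<alpha> Q l c"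
  let ?N = "\<lambda>l. Q_plus \<gamma> \<epsilon> q h \<alpha> Q l c"
  let ?M = "\<lambda>l. Q_minus \<gamma> \<epsilon> q h \<alpha> Q l (c - axis l 1)"
  let ?B = "\<lambda>l. Q_plus \<gamma> \<epsilon> q h \<alpha> Q l (c - axis l 1)"
  let ?P = "\<lambda>s l R. f (\<alpha> $ l *\<^sub>R R + s *\<^sub>R flux \<gamma> l R)"
  \<comment> \<open>The neighbours' states \<open>?N\<close> and \<open>?M\<close> already enter the
    update in split form. The cell's own states \<open>?A\<close> and \<open>?B\<close> get it by
    adding \<open>\<alpha> $ l\<close> times the state, which the remainder subtracts again.\<close>
  let ?G = "\<lambda>l. dt / h $ l / 2 *
    (?P (- 1) l (?N l) + ?P 1 l (?M l) + ?P (- 1) l (?A l) + ?P 1 l (?B l))"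
  have "dt / h $ l * f (lf_flux \<gamma> \<alpha> l (?A l) (?N l) - lf_flux \<gamma> \<alpha> l (?M l) (?B l)) =
      dt / h $ l * \<alpha> $ l * (f (?A l) + f (?B l)) - ?G l" for l
    by (simp add: lf_flux_def lin) (simp add: algebra_simps add_divide_distrib diff_divide_distrib)
  then have "f (updated \<gamma> \<epsilon> q h dt \<alpha> Q c) = f (Q c)
      - (\<Sum>l\<in>UNIV. dt / h $ l * \<alpha> $ l * (f (?A l) + f (?B l))) + (\<Sum>l\<in>UNIV. ?G l)"
    by (simp add: updated_def lin(2-4) sum_subtractf)
  moreover have "0 < (\<Sum>l\<in>UNIV. ?G l)"
  proof (rule sum_pos)
    fix l :: 3
    have "?A l \<in> interface_states \<gamma> \<epsilon> q h \<alpha> Q {c}" "?N l \<in> interface_states \<gamma> \<epsilon> q h \<alpha> Q {c}"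
      "?M l \<in> interface_states \<gamma> \<epsilon> q h \<alpha> Q {c}" "?B l \<in> interface_states \<gamma> \<epsilon> q h \<alpha> Q {c}"
      by (auto simp: interface_states_def)
    then show "0 < ?G l"
      using assms(2) h[of l] by (intro mult_pos_pos add_pos_pos split) auto
  qed auto
  ultimately show ?thesis using remainder by linarith
qed

theorem theorem4p1:
  fixes \<gamma> \<epsilon> q dt :: real
    and h \<alpha> :: "real ^ 3"
    and Q :: "cell \<Rightarrow> conserved"
    and M :: "cell set"
  assumes "\<gamma> > 1" and "\<epsilon> > 0" and "q > 2" and "dt > 0"
    and "\<And>l. h $ l > 0"
    and "\<And>c. Q c \<in> admissible"
    and "\<And>l R. R \<in> interface_states \<gamma> \<epsilon> q h \<alpha> Q M \<Longrightarrow>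
      \<bar>velocity (prim \<gamma> R) $ l\<bar> + sound_speed \<gamma> (prim \<gamma> R) \<le> \<alpha> $ l"
    and "dt * (\<alpha> $ 1 / h $ 1 + \<alpha> $ 2 / h $ 2 + \<alpha> $ 3 / h $ 3) \<le> 1 / q"
  shows "\<forall>c\<in>M. updated \<gamma> \<epsilon> q h dt \<alpha> Q c \<in> admissible"
proof
  fix c assume c: "c \<in> M"
  define W where "W = (\<lambda>c. prim \<gamma> (Q c))"
  have W: "density (W c') > 0" "pressure (W c') > 0" for c'
    using prim_positive[OF assms(1,6)] by (auto simp: W_def)
  have consW: "cons \<gamma> (W c) = Q c"
    using assms(1) assms(6)[of c] by (simp add: W_def cons_prim admissible_iff_moving_energy)
  let ?F = "\<lambda>s l. cons \<gamma> (face_value \<gamma> \<epsilon> q h \<alpha> W s l c)"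
  \<comment> \<open>Both remainder states belong to \<open>c\<close> itself: the right limit at the
    interface of \<open>c - axis l 1\<close> is the value of \<open>c\<close> at its lower
    face.\<close>
  have A: "Q_minus \<gamma> \<epsilon> q h \<alpha> Q l c = ?F 1 l"
    and B: "Q_plus \<gamma> \<epsilon> q h \<alpha> Q l (c - axis l 1) = ?F (- 1) l" for l
    by (simp_all add: Q_minus_def Q_plus_def W_def)
  have interface: "\<exists>V. R = cons \<gamma> V \<and> density V > 0 \<and> pressure V > 0
      \<and> (\<forall>l. \<bar>velocity V $ l\<bar> + sound_speed \<gamma> V \<le> \<alpha> $ l)"
    if R: "R \<in> interface_states \<gamma> \<epsilon> q h \<alpha> Q {c}" for R
  proof -
    obtain s l c' where "\<bar>s\<bar> = 1" "R = cons \<gamma> (face_value \<gamma> \<epsilon> q h \<alpha> W s l c')"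
    proof -
      obtain l c' where "R = Q_minus \<gamma> \<epsilon> q h \<alpha> Q l c' \<or> R = Q_plus \<gamma> \<epsilon> q h \<alpha> Q l c'"
        using R by (auto simp: interface_states_def)
      then show ?thesis
        using that[of 1 l c'] that[of "- 1" l "c' + axis l 1"]
        by (auto simp: Q_minus_def Q_plus_def W_def)
    qed
    then obtain V where V: "R = cons \<gamma> V" "density V > 0" "pressure V > 0"
      using face_value_positive[where W = W, OF assms(2) W] by blast
    have "R \<in> interface_states \<gamma> \<epsilon> q h \<alpha> Q M"
      using R c by (auto simp: interface_states_def)
    from assms(7)[OF this] V assms(1) show ?thesis by (intro exI[of _ V]) (auto simp: prim_cons)
  qed
  \<comment> \<open>Positivity of \<open>\<alpha>\<close> comes from the speed bound, because the
    sound speed of a limited state is positive.\<close>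
  have \<alpha>: "\<alpha> $ l > 0" for l
  proof -
    have "Q_minus \<gamma> \<epsilon> q h \<alpha> Q l c \<in> interface_states \<gamma> \<epsilon> q h \<alpha> Q {c}"
      by (auto simp: interface_states_def)
    from interface[OF this] obtain V where V: "density V > 0" "pressure V > 0"
      "\<bar>velocity V $ l\<bar> + sound_speed \<gamma> V \<le> \<alpha> $ l" by blast
    moreover have "sound_speed \<gamma> V > 0"
      using V assms(1) by (simp add: sound_speed_def)
    ultimately show ?thesis by linarith
  qed
  have split: "0 < fst (\<alpha> $ l *\<^sub>R R + s *\<^sub>R flux \<gamma> l R)"
    "0 < moving_energy w (\<alpha> $ l *\<^sub>R R + s *\<^sub>R flux \<gamma> l R)"
    if "R \<in> interface_states \<gamma> \<epsilon> q h \<alpha> Q {c}" "\<bar>s\<bar> = 1" for R s l w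
    using interface[OF that(1)] split_flux_positive[OF assms(1) _ _ _ that(2)] by blast+
  have "0 < fst (updated \<gamma> \<epsilon> q h dt \<alpha> Q c)"
  proof (rule linear_update_positive[OF linear_fst assms(4,5) split(1)])
    \<comment> \<open>The density increments cancel between opposite faces, leaving twice the CFL
      number times the mean density; \<open>q > 2\<close> keeps this below the mean.\<close>
    have "(\<Sum>l\<in>UNIV. dt / h $ l * \<alpha> $ l * (fst (?F 1 l) + fst (?F (- 1) l))) =
        (dt * (\<alpha> $ 1 / h $ 1 + \<alpha> $ 2 / h $ 2 + \<alpha> $ 3 / h $ 3)) * (2 * density (W c))"
      by (simp add: face_value_def sum_3 algebra_simps)
    also have "\<dots> \<le> (1 / q) * (2 * density (W c))"
      using assms(8) W[of c] by (intro mult_right_mono) auto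
    also have "\<dots> \<le> density (W c)"
      using assms(3) W[of c] by (simp add: field_simps)
    also have "\<dots> = fst (Q c)" by (simp flip: consW)
    finally show "(\<Sum>l\<in>UNIV. dt / h $ l * \<alpha> $ l * (fst (Q_minus \<gamma> \<epsilon> q h \<alpha> Q l c)
        + fst (Q_plus \<gamma> \<epsilon> q h \<alpha> Q l (c - axis l 1)))) \<le> fst (Q c)"
      unfolding A B .
  qed
  moreover have "0 < moving_energy w (updated \<gamma> \<epsilon> q h dt \<alpha> Q c)" for w
  proof (rule linear_update_positive[OF linear_moving_energy assms(4,5) split(2)])
    show "(\<Sum>l\<in>UNIV. dt / h $ l * \<alpha> $ l * (moving_energy w (Q_minus \<gamma> \<epsilon> q h \<alpha> Q l c)
        + moving_energy w (Q_plus \<gamma> \<epsilon> q h \<alpha> Q l (c - axis l 1)))) \<le> moving_energy w (Q c)"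
      unfolding A B consW[symmetric]
      by (rule remainder_energy_nonneg[OF assms(1,3,4,5) \<alpha> W assms(8)])
  qed
  ultimately show "updated \<gamma> \<epsilon> q h dt \<alpha> Q c \<in> admissible"
    by (simp add: admissible_iff_moving_energy)
qed

end
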